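(* Let $\psi(x,t)\ge0$ satisfy the nonlinear problem $$\frac{\partial \psi}{\partial t} = D\frac{\partial^2\psi}{\partial x^2}+f(\psi) \quad\text{in } 0<x<L(t),\qquad \psi(0,t)=\psi(L(t),t)=0,$$ where $f$ is of KPP type, i.e. $f$ is Lipschitz continuous, differentiable at $0$, and satisfies $$f(0)=f(1)=0,\qquad f'(0)>0,\qquad \frac{f(k)}{k}\ \text{non-increasing on } k>0,$$ and where there is some $k_0>0$ such that $f(k)=f'(0)k$ for $0\le k\le k_0$. Assume that there exist finite constants $m_1,m_2,M,I_1,I_2$ such that for all $t\ge0$ $$0<m_1\le L(t)\le m_2,\qquad |\dot L(t)L(t)|\le M,$$ $$\left|\int_0^t\left(\frac{1}{L(\zeta)^2}-\frac{1}{L_{crit}^2}\right)d\zeta\right|\le I_1,\qquad \int_0^tL(\zeta)[\ddot L(\zeta)]^-\,d\zeta\le I_2.$$ Then for $\psi(x,0)\ge0$ and not identically zero, $\psi(x,t)$ does not converge to zero as $t\to\infty$. In particular, $$\liminf_{t\to\infty}\left(\frac{2}{L(t)}\int_0^{L(t)}\psi(x,t)\sin\left(\frac{\pi x}{L(t)}\right)dx\right)>0.$$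
   Context: Here $D>0$ is a constant and $L_{crit}=\pi\sqrt{D/f'(0)}$. The function $L(t)$ is a prescribed twice continuously differentiable function of $t\ge0$ with $L(t)>0$ for all $t\ge0$; dots denote derivatives with respect to $t$. Solutions $\psi$ are non-negative, and the problem is posed for $t\ge0$. For any function $F(t)$, $[F(t)]^+\ge0$ and $[F(t)]^-\ge0$ denote its positive and negative parts, so that $F(t)\equiv[F(t)]^+-[F(t)]^-$. *)

theory Defs
  imports "HOL-Analysis.Analysis"
begin

text \<open>Since solutions are non-negative, only the values of \<open>f\<close> on \<open>[0, \<infinity>)\<close> matter; in particular
  \<open>r = f'(0)\<close> is the one-sided derivative.\<close>

definition KPP_type :: "(real \<Rightarrow> real) \<Rightarrow> real \<Rightarrow> bool" where
  "KPP_type f r \<longleftrightarrow>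
     (\<exists>K. K-lipschitz_on {0..} f) \<and>
     f 0 = 0 \<and> f 1 = 0 \<and>
     (f has_real_derivative r) (at 0 within {0..}) \<and> r > 0 \<and>
     antimono_on {0<..} (\<lambda>k. f k / k)"

definition L_crit :: "real \<Rightarrow> real \<Rightarrow> real" where
  "L_crit D r = pi * sqrt (D / r)"

definition neg_part :: "real \<Rightarrow> real" where
  "neg_part y = max 0 (- y)"

text \<open>Non-negative classical solutions on the moving interval \<open>0 < x < L t\<close>. The equation is imposed
  pointwise for \<open>t > 0\<close>; up to the boundary and the initial time only continuity is required,
  and not even that at the two corners \<open>(0, 0)\<close> and \<open>(L 0, 0)\<close>, so that the initial datum need not
  tend to zero at the end points. Values of \<open>\<psi>\<close> outside the domain are irrelevant.\<close>

definition nonneg_solution ::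
  "real \<Rightarrow> (real \<Rightarrow> real) \<Rightarrow> (real \<Rightarrow> real) \<Rightarrow> (real \<Rightarrow> real \<Rightarrow> real) \<Rightarrow> bool" where
  "nonneg_solution D f L \<psi> \<longleftrightarrow>
     continuous_on ({(x, t). 0 \<le> t \<and> 0 \<le> x \<and> x \<le> L t} - {(0, 0), (L 0, 0)}) (\<lambda>(x, t). \<psi> x t) \<and>
     (\<forall>t\<ge>0. \<forall>x\<in>{0..L t}. \<psi> x t \<ge> 0) \<and>
     (\<forall>t\<ge>0. \<psi> 0 t = 0 \<and> \<psi> (L t) t = 0) \<and>
     (\<forall>t>0. \<forall>x\<in>{0<..<L t}.
        (\<lambda>s. \<psi> x s) differentiable (at t) \<and>
        (\<lambda>y. \<psi> y t) differentiable (at x) \<and>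
        deriv (\<lambda>y. \<psi> y t) differentiable (at x) \<and>
        deriv (\<lambda>s. \<psi> x s) t = D * deriv (deriv (\<lambda>y. \<psi> y t)) x + f (\<psi> x t))"

text \<open>Pointwise convergence to zero, with \<open>\<psi>\<close> extended by zero outside the moving interval. This is
  implied by uniform convergence, so its failure is the stronger negative statement.\<close>

definition tends_to_zero :: "(real \<Rightarrow> real) \<Rightarrow> (real \<Rightarrow> real \<Rightarrow> real) \<Rightarrow> bool" where
  "tends_to_zero L \<psi> \<longleftrightarrow>
     (\<forall>x. ((\<lambda>t. if x \<in> {0..L t} then \<psi> x t else 0) \<longlongrightarrow> 0) at_top)"

end

theory Submission
  imports Defs
begin

text \<open>The solution is bounded below by a positive multiple of \<open>sin (\<pi> x / L t)\<close>, uniformly in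
  \<open>t \<ge> t1\<close> for some \<open>t1 > 0\<close>. This bounds the sine moment from below, and also the value at
  the point \<open>m1 / 2\<close>, which stays in the interval away from its right end.

  The bound comes from the explicit function
    \<open>v x t = \<epsilon> exp (g t - L' t x\<^sup>2 / (4 D L t)) sin (\<pi> x / L t)\<close>,
    \<open>g t = - D \<pi>\<^sup>2 \<integral>\<^sub>0\<^sup>t (1 / L\<^sup>2 - 1 / L_crit\<^sup>2) - ln (L t) / 2 - (1 / 4 D) \<integral>\<^sub>0\<^sup>t L [L'']\<^sup>-\<close>.
  It satisfies \<open>v_t \<le> D v_xx + r v\<close>, because \<open>D \<pi>\<^sup>2 / L_crit\<^sup>2 = r\<close>, and the bounds on \<open>L\<close>, on
  \<open>L' L\<close> and on the two integrals keep its exponent between two constants. For small \<open>\<epsilon>\<close> it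
  therefore stays below \<open>k0\<close>, where \<open>f\<close> is linear, so it is a subsolution of the nonlinear problem
  (\<open>moving_sine_subsolution_bound\<close>), and it remains below \<open>\<psi>\<close> if it is below \<open>\<psi>\<close> at time \<open>t1\<close>
  (\<open>nonneg_solution_comparison\<close>).

  What remains is that \<open>\<psi>\<close> dominates a multiple of the sine at one positive time, which is the
  strong maximum principle together with Hopf's boundary lemma. Both follow in one step from
  comparison with a Gaussian barrier on an interval which grows from a place where \<open>\<psi>\<close> is
  positive to the whole of \<open>[0, L t]\<close> (\<open>nonneg_solution_ge_sin_after_unit_time\<close>). It starts at a
  small positive time rather than at \<open>0\<close>, since \<open>\<psi>\<close> may be discontinuous at the two corners.\<close>

section \<open>Comparison with subsolutions\<close>

lemma second_derivative_nonpos_at_max: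
  fixes u u' :: "real \<Rightarrow> real"
  assumes "a < x" "x < b"
    and u: "\<And>y. a < y \<Longrightarrow> y < b \<Longrightarrow> (u has_real_derivative u' y) (at y)"
    and u': "(u' has_real_derivative u2) (at x)"
    and max: "\<And>y. a < y \<Longrightarrow> y < b \<Longrightarrow> u y \<le> u x"
  shows "u2 \<le> 0"
proof (rule ccontr)
  assume "\<not> u2 \<le> 0"
  have "u' x = 0"
  proof (rule DERIV_local_max[OF u[OF assms(1,2)]])
    show "0 < min (x - a) (b - x)" using assms(1,2) by simp
    show "\<forall>y. \<bar>x - y\<bar> < min (x - a) (b - x) \<longrightarrow> u y \<le> u x"
      using max by (auto simp: abs_less_iff)
  qed
  moreover obtain d where d: "d > 0" "\<And>h. 0 < h \<Longrightarrow> h < d \<Longrightarrow> u' x < u' (x + h)"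
    using DERIV_pos_inc_right[OF u'] \<open>\<not> u2 \<le> 0\<close> by force
  ultimately have pos: "u' (x + h) > 0" if "0 < h" "h < d" for h
    using that by metis
  define k where "k = min d (b - x) / 2"
  have k: "0 < k" "k < d" "x + k < b" using d(1) assms(2) by (auto simp: k_def min_def field_simps)
  have "\<exists>z>x. z < x + k \<and> u (x + k) - u x = (x + k - x) * u' z"
    using k assms(1,2) by (intro MVT2 u) auto
  then obtain z where z: "x < z" "z < x + k" "u (x + k) - u x = k * u' z" by auto
  have "u' z > 0" using pos[of "z - x"] z k by simp
  with z k have "u (x + k) > u x" by (smt (verit) mult_pos_pos)
  with max[of "x + k"] k assms(1) show False by simp
qed

lemma compact_moving_interval:
  fixes L :: "real \<Rightarrow> real"
  assumes "continuous_on {t0..t1} L" and "\<And>t. t \<in> {t0..t1} \<Longrightarrow> L t > 0"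
  shows "compact {(x, t). t0 \<le> t \<and> t \<le> t1 \<and> 0 \<le> x \<and> x \<le> L t}" (is "compact ?S")
proof -
  have "?S = (\<lambda>(s, t). (s * L t, t)) ` ({0..1} \<times> {t0..t1})"
  proof (intro equalityI subsetI)
    fix p assume "p \<in> ?S"
    then obtain x t where p: "p = (x, t)" "t0 \<le> t" "t \<le> t1" "0 \<le> x" "x \<le> L t" by auto
    then have "L t > 0" using assms(2) by auto
    then have "p = (\<lambda>(s, t). (s * L t, t)) (x / L t, t)" "(x / L t, t) \<in> {0..1} \<times> {t0..t1}"
      using p by auto
    then show "p \<in> (\<lambda>(s, t). (s * L t, t)) ` ({0..1} \<times> {t0..t1})" by blast
  next
    fix p assume "p \<in> (\<lambda>(s, t). (s * L t, t)) ` ({0..1} \<times> {t0..t1})"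
    then obtain q where "q \<in> {0..1} \<times> {t0..t1}" "p = (\<lambda>(s, t). (s * L t, t)) q" by blast
    then show "p \<in> ?S"
      using assms(2)[of "snd q"] by (cases q) (auto simp: mult_le_cancel_right1)
  qed
  moreover have "continuous_on ({0..1} \<times> {t0..t1}) (\<lambda>(s, t). (s * L t, t))"
    unfolding case_prod_beta
    by (intro continuous_intros continuous_on_compose2[OF assms(1)]) auto
  ultimately show ?thesis
    using compact_continuous_image[OF _ compact_Times[OF compact_Icc compact_Icc]] by simp
qed

text \<open>The comparison function \<open>v\<close> need be a subsolution only where it exceeds the solution, so
  that it may take negative values. At a positive maximum of \<open>exp (- (K + 1) t) (v - \<psi>)\<close> the
  zeroth-order term, which beats the Lipschitz constant \<open>K\<close>, makes the time derivative strictly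
  negative, although it has to be nonnegative there.\<close>

lemma nonneg_solution_comparison:
  fixes L :: "real \<Rightarrow> real" and v vt vx vxx :: "real \<Rightarrow> real \<Rightarrow> real"
  assumes sol: "nonneg_solution D f L \<psi>" and D: "D > 0" and lip: "K-lipschitz_on {0..} f"
    and t0: "0 < t0"
    and Lcont: "continuous_on {t0..t1} L" and Lpos: "\<And>t. t \<in> {t0..t1} \<Longrightarrow> L t > 0"
    and vcont: "continuous_on {(x, t). t0 \<le> t \<and> t \<le> t1 \<and> 0 \<le> x \<and> x \<le> L t} (\<lambda>(x, t). v x t)"
    and init: "\<And>x. x \<in> {0..L t0} \<Longrightarrow> v x t0 \<le> \<psi> x t0"
    and left: "\<And>t. t \<in> {t0..t1} \<Longrightarrow> v 0 t \<le> 0"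
    and right: "\<And>t. t \<in> {t0..t1} \<Longrightarrow> v (L t) t \<le> 0"
    and vt: "\<And>x t. t \<in> {t0<..t1} \<Longrightarrow> x \<in> {0<..<L t} \<Longrightarrow>
               ((\<lambda>s. v x s) has_real_derivative vt x t) (at t)"
    and vx: "\<And>x t. t \<in> {t0<..t1} \<Longrightarrow> x \<in> {0<..<L t} \<Longrightarrow>
               ((\<lambda>y. v y t) has_real_derivative vx x t) (at x)"
    and vxx: "\<And>x t. t \<in> {t0<..t1} \<Longrightarrow> x \<in> {0<..<L t} \<Longrightarrow>
               ((\<lambda>y. vx y t) has_real_derivative vxx x t) (at x)"
    and sub: "\<And>x t. t \<in> {t0<..t1} \<Longrightarrow> x \<in> {0<..<L t} \<Longrightarrow> \<psi> x t < v x t \<Longrightarrow>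
               vt x t \<le> D * vxx x t + f (v x t)"
    and t: "t \<in> {t0..t1}" and x: "x \<in> {0..L t}"
  shows "v x t \<le> \<psi> x t"
proof (rule ccontr)
  assume contra: "\<not> v x t \<le> \<psi> x t"
  let ?S = "{(x, t). t0 \<le> t \<and> t \<le> t1 \<and> 0 \<le> x \<and> x \<le> L t}"
  define g where "g = (\<lambda>(x, t). exp (- (K + 1) * t) * (v x t - \<psi> x t))"
  have psicont: "continuous_on ?S (\<lambda>(x, t). \<psi> x t)"
    using sol t0 unfolding nonneg_solution_def by (auto elim!: continuous_on_subset)
  have "continuous_on ?S g"
    using vcont psicont unfolding g_def case_prod_beta
    by (intro continuous_intros) auto
  moreover have inS: "(x, t) \<in> ?S" using t x by auto
  then have "?S \<noteq> {}" by blast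
  ultimately have "\<exists>p\<in>?S. \<forall>y\<in>?S. g y \<le> g p"
    by (intro continuous_attains_sup compact_moving_interval[OF Lcont Lpos])
  then obtain p where p: "p \<in> ?S" "\<And>y. y \<in> ?S \<Longrightarrow> g y \<le> g p" by blast
  obtain y s where ps: "p = (y, s)" by force
  have ys: "t0 \<le> s" "s \<le> t1" "0 \<le> y" "y \<le> L s" using p(1) ps by auto
  have "g (x, t) > 0" using contra by (simp add: g_def)
  then have "g (y, s) > 0" using p(2)[OF inS] ps by auto
  then have vpsi: "\<psi> y s < v y s" by (simp add: g_def zero_less_mult_iff)
  have psi0: "\<psi> 0 s = 0" "\<psi> (L s) s = 0" "\<psi> y s \<ge> 0"
    using sol ys t0 unfolding nonneg_solution_def by auto
  have "y \<noteq> 0" "y \<noteq> L s" using vpsi left[of s] right[of s] ys psi0 by auto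
  then have yint: "0 < y" "y < L s" using ys by auto
  have "s \<noteq> t0" using init[of y] vpsi ys by auto
  then have sint: "s \<in> {t0<..t1}" using ys by auto
  have s0: "s > 0" using sint t0 by auto
  have classical: "(\<lambda>s. \<psi> z s) differentiable (at s) \<and> (\<lambda>y. \<psi> y s) differentiable (at z) \<and>
      deriv (\<lambda>y. \<psi> y s) differentiable (at z) \<and>
      deriv (\<lambda>s. \<psi> z s) s = D * deriv (deriv (\<lambda>y. \<psi> y s)) z + f (\<psi> z s)"
    if "0 < z" "z < L s" for z
    using sol s0 that unfolding nonneg_solution_def by auto
  then have psit: "((\<lambda>s. \<psi> y s) has_real_derivative deriv (\<lambda>s. \<psi> y s) s) (at s)"
    and psix: "\<And>z. 0 < z \<Longrightarrow> z < L s \<Longrightarrow>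
        ((\<lambda>y. \<psi> y s) has_real_derivative deriv (\<lambda>y. \<psi> y s) z) (at z)"
    and psixx: "(deriv (\<lambda>y. \<psi> y s) has_real_derivative deriv (deriv (\<lambda>y. \<psi> y s)) y) (at y)"
    and pde: "deriv (\<lambda>s. \<psi> y s) s = D * deriv (deriv (\<lambda>y. \<psi> y s)) y + f (\<psi> y s)"
    using yint by (blast intro: DERIV_deriv_iff_real_differentiable[THEN iffD2])+
  have xx: "vxx y s - deriv (deriv (\<lambda>y. \<psi> y s)) y \<le> 0"
  proof (rule second_derivative_nonpos_at_max[OF yint,
        where u = "\<lambda>z. v z s - \<psi> z s" and u' = "\<lambda>z. vx z s - deriv (\<lambda>y. \<psi> y s) z"])
    fix z assume z: "0 < z" "z < L s"
    show "((\<lambda>z. v z s - \<psi> z s) has_real_derivative vx z s - deriv (\<lambda>y. \<psi> y s) z) (at z)"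
      using vx[OF sint] psix z by (auto intro!: derivative_intros)
    have "g (z, s) \<le> g (y, s)" using p(2)[of "(z, s)"] z ys ps by auto
    then show "v z s - \<psi> z s \<le> v y s - \<psi> y s" by (simp add: g_def)
  next
    show "((\<lambda>z. vx z s - deriv (\<lambda>y. \<psi> y s) z) has_real_derivative
        vxx y s - deriv (deriv (\<lambda>y. \<psi> y s)) y) (at y)"
      using vxx[OF sint] psixx yint by (auto intro!: derivative_intros)
  qed
  have K: "f (v y s) - f (\<psi> y s) \<le> K * (v y s - \<psi> y s)"
    using lipschitz_onD[OF lip, of "v y s" "\<psi> y s"] vpsi psi0 by (auto simp: dist_real_def)
  have tneg: "vt y s - deriv (\<lambda>s. \<psi> y s) s - (K + 1) * (v y s - \<psi> y s) < 0"
  proof -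
    have "vt y s - deriv (\<lambda>s. \<psi> y s) s
        \<le> D * (vxx y s - deriv (deriv (\<lambda>y. \<psi> y s)) y) + (f (v y s) - f (\<psi> y s))"
      using sub[OF sint _ vpsi] yint pde by (auto simp: algebra_simps)
    also have "\<dots> \<le> 0 + K * (v y s - \<psi> y s)"
      using xx D K by (intro add_mono mult_nonneg_nonpos) auto
    finally show ?thesis using vpsi by (simp add: algebra_simps)
  qed
  have "((\<lambda>s. g (y, s)) has_real_derivative
      exp (- (K + 1) * s) * (vt y s - deriv (\<lambda>s. \<psi> y s) s - (K + 1) * (v y s - \<psi> y s))) (at s)"
    using vt[OF sint, of y] yint psit unfolding g_def
    by (auto intro!: derivative_eq_intros simp: algebra_simps)
  from DERIV_neg_dec_left[OF this mult_pos_neg[OF exp_gt_zero tneg]]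
  obtain d where d: "d > 0" "\<And>h. 0 < h \<Longrightarrow> h < d \<Longrightarrow> g (y, s) < g (y, s - h)"
    by blast
  obtain e where e: "e > 0"
    "\<And>s'. s' \<in> {t0..t1} \<Longrightarrow> dist s' s < e \<Longrightarrow> dist (L s') (L s) < L s - y"
    using Lcont[unfolded continuous_on_iff, rule_format, of s "L s - y"] ys yint by auto
  \<comment> \<open>A slightly earlier point lies in the domain and has a larger value of \<open>g\<close>.\<close>
  define h where "h = min (min d e) (s - t0) / 2"
  have h: "0 < h" "h < d" "h < e" "h < s - t0"
    using d(1) e(1) sint by (auto simp: h_def min_def)
  have "dist (L (s - h)) (L s) < L s - y"
    using e(2)[of "s - h"] h sint by (auto simp: dist_real_def)
  then have "(y, s - h) \<in> ?S" using h sint yint by (auto simp: dist_real_def)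
  then show False using d(2)[OF h(1,2)] p(2)[of "(y, s - h)"] ps by auto
qed

section \<open>Positivity up to the boundary after unit time\<close>

text \<open>The differential inequality for the barrier \<open>exp (- \<alpha> y\<^sup>2) - exp (- \<alpha>)\<close>, where
  \<open>y = (x - C t) / R t\<close>, in the interval with moving centre \<open>C\<close> and radius \<open>R\<close>. Near its ends
  (\<open>y\<^sup>2 \<ge> 1/2\<close>) the term quadratic in \<open>\<alpha>\<close> dominates, and elsewhere the decay rate \<open>\<Lambda>\<close> does.\<close>

lemma moving_bump_inequality:
  fixes y :: real
  assumes D: "D > 0" and R0: "0 < R0" "R0 \<le> R" "R \<le> m"
    and B: "\<bar>C'\<bar> \<le> B" "\<bar>R'\<bar> \<le> B" and y: "\<bar>y\<bar> < 1"
    and al: "\<alpha> \<ge> 1 + 2 * B * m\<^sup>2 / (R0 * D)"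
    and La: "\<Lambda> \<ge> K + (2 * \<alpha> * D / R0\<^sup>2 + 4 * \<alpha> * B / R0) / (1 - exp (- \<alpha> / 2))"
  defines "E \<equiv> exp (- \<alpha> * y\<^sup>2)"
  shows "- \<Lambda> * (E - exp (- \<alpha>)) + E * (2 * \<alpha> * y * (C' + y * R') / R)
      \<le> D * (E * (4 * \<alpha>\<^sup>2 * y\<^sup>2 / R\<^sup>2 - 2 * \<alpha> / R\<^sup>2)) - K * (E - exp (- \<alpha>))"
proof -
  have B0: "B \<ge> 0" using B by linarith
  have m0: "m > 0" "R > 0" using R0 by auto
  have "2 * B * m\<^sup>2 / (R0 * D) \<ge> 0" using B0 D R0 by simp
  then have al1: "\<alpha> \<ge> 1" using al by linarith
  have E0: "E > 0" by (simp add: E_def)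
  have y2: "y\<^sup>2 < 1" using y by (simp add: abs_square_less_1)
  have EE: "E - exp (- \<alpha>) = E * (1 - exp (- \<alpha> * (1 - y\<^sup>2)))"
    by (simp add: E_def algebra_simps flip: exp_add)
  have bnd: "2 * \<alpha> * y * (C' + y * R') / R \<le> 4 * \<alpha> * B / R0"
  proof -
    have "y * (C' + y * R') \<le> \<bar>y\<bar> * \<bar>C' + y * R'\<bar>" by (metis abs_ge_self abs_mult)
    also have "\<dots> \<le> 1 * (2 * B)"
    proof (intro mult_mono)
      have "\<bar>y * R'\<bar> \<le> 1 * B" unfolding abs_mult using y B by (intro mult_mono) auto
      then show "\<bar>C' + y * R'\<bar> \<le> 2 * B" using B by linarith
    qed (use y B0 in auto)
    finally have 1: "2 * \<alpha> * (y * (C' + y * R')) \<le> 2 * \<alpha> * (2 * B)"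
      using al1 by (intro mult_left_mono) auto
    have "2 * \<alpha> * (y * (C' + y * R')) / R \<le> 2 * \<alpha> * (2 * B) / R"
      using 1 m0 by (intro divide_right_mono) auto
    also have "\<dots> \<le> 2 * \<alpha> * (2 * B) / R0"
      using al1 B0 R0 by (intro divide_left_mono) auto
    finally show ?thesis by (simp add: algebra_simps)
  qed
  have Lpos: "\<Lambda> - K \<ge> (2 * \<alpha> * D / R0\<^sup>2 + 4 * \<alpha> * B / R0) / (1 - exp (- \<alpha> / 2))"
    using La by simp
  have ehalf: "exp (- \<alpha> / 2) < 1" using al1 by simp
  have num0: "0 \<le> 2 * \<alpha> * D / R0\<^sup>2 + 4 * \<alpha> * B / R0" using al1 D B0 R0 by simp
  have LK: "\<Lambda> - K \<ge> 0"
    using Lpos divide_nonneg_nonneg[OF num0, of "1 - exp (- \<alpha> / 2)"] ehalf by linarith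
  have "2 * \<alpha> * y * (C' + y * R') / R
      \<le> D * (4 * \<alpha>\<^sup>2 * y\<^sup>2 / R\<^sup>2 - 2 * \<alpha> / R\<^sup>2) + (\<Lambda> - K) * (1 - exp (- \<alpha> * (1 - y\<^sup>2)))"
  proof (cases "y\<^sup>2 \<ge> 1/2")
    case True
    have "exp (- \<alpha> * (1 - y\<^sup>2)) \<le> 1" using y2 al1 by simp
    then have 1: "0 \<le> (\<Lambda> - K) * (1 - exp (- \<alpha> * (1 - y\<^sup>2)))" using LK by simp
    have "4 * B / R0 * R\<^sup>2 \<le> 4 * B / R0 * m\<^sup>2"
      using R0 B0 by (intro mult_left_mono power_mono) auto
    also have "\<dots> = 2 * D * (2 * B * m\<^sup>2 / (R0 * D))" using D R0 by (simp add: field_simps)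
    also have "\<dots> \<le> 2 * D * (\<alpha> - 1)" using al D by (intro mult_left_mono) auto
    finally have "4 * B / R0 \<le> 2 * D * (\<alpha> - 1) / R\<^sup>2"
      using m0 by (simp add: pos_le_divide_eq)
    then have "\<alpha> * (4 * B / R0) \<le> \<alpha> * (2 * D * (\<alpha> - 1) / R\<^sup>2)"
      using al1 by (intro mult_left_mono) auto
    also have "\<dots> = D * (4 * \<alpha>\<^sup>2 * (1/2) / R\<^sup>2 - 2 * \<alpha> / R\<^sup>2)"
      using m0 by (simp add: field_simps power2_eq_square)
    also have "\<dots> \<le> D * (4 * \<alpha>\<^sup>2 * y\<^sup>2 / R\<^sup>2 - 2 * \<alpha> / R\<^sup>2)"
      using True D al1
      by (intro mult_left_mono diff_right_mono divide_right_mono) auto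
    finally show ?thesis using bnd 1 by (simp add: algebra_simps)
  next
    case False
    have "2 * \<alpha> * D / R0\<^sup>2 + 4 * \<alpha> * B / R0 \<le> (\<Lambda> - K) * (1 - exp (- \<alpha> / 2))"
      using Lpos ehalf by (simp add: pos_divide_le_eq)
    also have "\<dots> \<le> (\<Lambda> - K) * (1 - exp (- \<alpha> * (1 - y\<^sup>2)))"
    proof -
      have "\<alpha> * (1/2) \<le> \<alpha> * (1 - y\<^sup>2)" using False al1 by (intro mult_left_mono) auto
      then show ?thesis using LK by (intro mult_left_mono) auto
    qed
    finally have 1: "2 * \<alpha> * D / R0\<^sup>2 + 4 * \<alpha> * B / R0 \<le> \<dots>" .
    have "2 * \<alpha> * D / R\<^sup>2 \<le> 2 * \<alpha> * D / R0\<^sup>2"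
      using al1 D R0 by (intro divide_left_mono power_mono mult_pos_pos) auto
    moreover have "D * (4 * \<alpha>\<^sup>2 * y\<^sup>2 / R\<^sup>2) \<ge> 0" using D by simp
    ultimately have "- (2 * \<alpha> * D / R0\<^sup>2)
        \<le> D * (4 * \<alpha>\<^sup>2 * y\<^sup>2 / R\<^sup>2) - 2 * \<alpha> * D / R\<^sup>2" by simp
    also have "\<dots> = D * (4 * \<alpha>\<^sup>2 * y\<^sup>2 / R\<^sup>2 - 2 * \<alpha> / R\<^sup>2)"
      by (simp add: algebra_simps)
    finally show ?thesis using bnd 1 by linarith
  qed
  then have "E * (2 * \<alpha> * y * (C' + y * R') / R)
      \<le> E * (D * (4 * \<alpha>\<^sup>2 * y\<^sup>2 / R\<^sup>2 - 2 * \<alpha> / R\<^sup>2) + (\<Lambda> - K) * (1 - exp (- \<alpha> * (1 - y\<^sup>2))))"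
    using E0 by (intro mult_left_mono) auto
  then show ?thesis unfolding EE by (simp add: algebra_simps)
qed

lemma sin_pi_le_parabola:
  fixes z :: real
  assumes "0 \<le> z" "z \<le> 1"
  shows "sin (pi * z) \<le> 2 * pi * (z * (1 - z))"
proof -
  have 1: "sin (pi * z) \<le> pi * z" using assms by (intro sin_x_le_x) auto
  have "sin (pi * z) = sin (pi * (1 - z))" by (simp add: right_diff_distrib)
  also have "\<dots> \<le> pi * (1 - z)" using assms by (intro sin_x_le_x) auto
  finally have 2: "sin (pi * z) \<le> pi * (1 - z)" .
  show ?thesis
  proof (cases "z \<le> 1/2")
    case True
    have "z * 1 \<le> z * (2 * (1 - z))" using True assms by (intro mult_left_mono) auto
    then have "pi * z \<le> pi * (z * (2 * (1 - z)))" by (intro mult_left_mono) auto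
    also have "\<dots> = 2 * pi * (z * (1 - z))" by simp
    finally show ?thesis using 1 by linarith
  next
    case False
    have "1 * (1 - z) \<le> (2 * z) * (1 - z)" using False assms by (intro mult_right_mono) auto
    then have "pi * (1 - z) \<le> pi * ((2 * z) * (1 - z))" by (intro mult_left_mono) auto
    also have "\<dots> = 2 * pi * (z * (1 - z))" by simp
    finally show ?thesis using 2 by linarith
  qed
qed


text \<open>Unit time is merely a convenient normalisation of the time in which the barrier's interval
  grows from \<open>[a, b]\<close> to \<open>[0, L t]\<close>. The barrier vanishes to first order at the ends of its interval,
  which makes the final lower bound linear at the boundary.\<close>

lemma nonneg_solution_ge_sin_after_unit_time:
  fixes L L' :: "real \<Rightarrow> real"
  assumes sol: "nonneg_solution D f L \<psi>" and D: "D > 0" and lip: "K-lipschitz_on {0..} f"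
    and f0: "f 0 = 0" and t0: "0 < t0"
    and L: "\<And>t. t0 \<le> t \<Longrightarrow> (L has_real_derivative L' t) (at t)"
    and m1: "0 < m1" and Lb: "\<And>t. t0 \<le> t \<Longrightarrow> m1 \<le> L t \<and> L t \<le> m2"
    and L'b: "\<And>t. t0 \<le> t \<Longrightarrow> \<bar>L' t\<bar> \<le> B"
    and ab: "0 \<le> a" "a < b" "b \<le> L t0"
    and \<delta>: "\<delta> > 0" "\<And>x. x \<in> {a..b} \<Longrightarrow> \<delta> \<le> \<psi> x t0"
  shows "\<exists>c>0. \<forall>x\<in>{0..L (t0 + 1)}. c * sin (pi * x / L (t0 + 1)) \<le> \<psi> x (t0 + 1)"
proof -
  define p q where "p = a / L t0" and "q = b / L t0"
  have L0: "L t0 > 0" using Lb[of t0] m1 by simp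
  have pq: "0 \<le> p" "p < q" "q \<le> 1" using ab L0 by (auto simp: p_def q_def divide_strict_right_mono)
  \<comment> \<open>The interval \<open>[C t - R t, C t + R t]\<close> is \<open>[a, b]\<close> at time \<open>t0\<close> and \<open>[0, L t]\<close> at time
    \<open>t0 + 1\<close>; relative to \<open>L t\<close>, its end points move with constant velocity.\<close>
  define C where "C = (\<lambda>t. L t * ((1 - (t - t0)) * (p + q) + (t - t0)) / 2)"
  define R where "R = (\<lambda>t. L t * ((1 - (t - t0)) * (q - p) + (t - t0)) / 2)"
  define C' where "C' = (\<lambda>t. L' t * ((1 - (t - t0)) * (p + q) + (t - t0)) / 2 + L t * (1 - (p + q)) / 2)"
  define R' where "R' = (\<lambda>t. L' t * ((1 - (t - t0)) * (q - p) + (t - t0)) / 2 + L t * (1 - (q - p)) / 2)"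
  define R0 where "R0 = m1 * (q - p) / 2"
  define B2 where "B2 = B + m2"
  have R0: "R0 > 0" using m1 pq by (simp add: R0_def)
  have B0: "B \<ge> 0" using L'b[of t0] by simp
  have m2: "m2 > 0" using Lb[of t0] m1 by simp
  have Cder: "(C has_real_derivative C' t) (at t)" and Rder: "(R has_real_derivative R' t) (at t)"
    if "t0 \<le> t" for t
    unfolding C_def C'_def R_def R'_def using L[OF that]
    by (auto intro!: derivative_eq_intros simp: field_simps)
  have facts: "R0 \<le> R t" "R t \<le> m2" "\<bar>C' t\<bar> \<le> B2" "\<bar>R' t\<bar> \<le> B2" "R t \<le> C t" "C t + R t \<le> L t"
    if t: "t \<in> {t0..t0 + 1}" for t
  proof -
    define \<mu> where "\<mu> = t - t0"
    have \<mu>: "0 \<le> \<mu>" "\<mu> \<le> 1" using t by (auto simp: \<mu>_def)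
    have Lt: "m1 \<le> L t" "L t \<le> m2" "\<bar>L' t\<bar> \<le> B" using Lb L'b t by auto
    define A where "A = (1 - \<mu>) * p"
    define A2 where "A2 = (1 - \<mu>) * q + \<mu>"
    have A: "0 \<le> A" using \<mu> pq by (simp add: A_def)
    have "(1 - \<mu>) * (1 - q) \<ge> 0" using \<mu> pq by simp
    then have A2: "A2 \<le> 1" by (simp add: A2_def algebra_simps)
    have "\<mu> * (1 - (q - p)) \<ge> 0" using \<mu> pq by simp
    then have AA: "q - p \<le> A2 - A" by (simp add: A_def A2_def algebra_simps)
    have Ceq: "C t = L t * (A + A2) / 2" "R t = L t * (A2 - A) / 2"
      "C' t = L' t * (A + A2) / 2 + L t * (1 - (p + q)) / 2"
      "R' t = L' t * (A2 - A) / 2 + L t * (1 - (q - p)) / 2"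
      by (simp_all add: C_def R_def C'_def R'_def A_def A2_def \<mu>_def algebra_simps)
    have "m1 * (q - p) \<le> L t * (A2 - A)" using AA Lt pq m1 by (intro mult_mono) auto
    then show "R0 \<le> R t" by (simp add: R0_def Ceq)
    have "L t * (A2 - A) \<le> m2 * 1" using AA A A2 Lt pq m1 by (intro mult_mono) auto
    then show "R t \<le> m2" using m2 by (simp add: Ceq)
    have bound: "\<bar>L' t * k / 2 + L t * l / 2\<bar> \<le> B2" if "0 \<le> k" "k \<le> 2" "\<bar>l\<bar> \<le> 1" for k l
    proof -
      have "\<bar>L' t * k\<bar> \<le> B * 2" unfolding abs_mult using that Lt B0 by (intro mult_mono) auto
      moreover have "\<bar>L t * l\<bar> \<le> m2 * 1" unfolding abs_mult using that Lt m1 by (intro mult_mono) auto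
      ultimately show ?thesis using m2 unfolding B2_def by linarith
    qed
    show "\<bar>C' t\<bar> \<le> B2" "\<bar>R' t\<bar> \<le> B2" using A A2 AA pq unfolding Ceq by (intro bound; simp)+
    have "L t * (2 * A) \<ge> 0" using Lt m1 A by simp
    then show "R t \<le> C t" by (simp add: Ceq algebra_simps)
    have "L t * A2 \<le> L t * 1" using Lt m1 A2 by (intro mult_left_mono) auto
    then show "C t + R t \<le> L t" by (simp add: Ceq field_simps)
  qed
  have Rpos: "R t > 0" if "t \<in> {t0..t0 + 1}" for t using facts(1)[OF that] R0 by simp
  define \<alpha> where "\<alpha> = 1 + 2 * B2 * m2\<^sup>2 / (R0 * D)"
  define \<Lambda> where "\<Lambda> = K + (2 * \<alpha> * D / R0\<^sup>2 + 4 * \<alpha> * B2 / R0) / (1 - exp (- \<alpha> / 2))"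
  have \<alpha>: "\<alpha> > 0" using B0 m2 R0 D by (simp add: \<alpha>_def B2_def add_pos_nonneg)
  define Y where "Y = (\<lambda>x t. (x - C t) / R t)"
  define E where "E = (\<lambda>x t. exp (- \<alpha> * (Y x t)\<^sup>2))"
  define v where "v = (\<lambda>x t. \<delta> * exp (- \<Lambda> * (t - t0)) * (E x t - exp (- \<alpha>)))"
  define vx where "vx = (\<lambda>x t. \<delta> * exp (- \<Lambda> * (t - t0)) * (E x t * (- 2 * \<alpha> * Y x t / R t)))"
  define vxx where "vxx = (\<lambda>x t. \<delta> * exp (- \<Lambda> * (t - t0)) *
      (E x t * (4 * \<alpha>\<^sup>2 * (Y x t)\<^sup>2 / (R t)\<^sup>2 - 2 * \<alpha> / (R t)\<^sup>2)))"
  define vt where "vt = (\<lambda>x t. \<delta> * exp (- \<Lambda> * (t - t0)) *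
      (- \<Lambda> * (E x t - exp (- \<alpha>)) + E x t * (2 * \<alpha> * Y x t * (C' t + Y x t * R' t) / R t)))"
  have v_pos_iff: "v x t > 0 \<longleftrightarrow> \<bar>Y x t\<bar> < 1" for x t
  proof -
    have "\<delta> * exp (- \<Lambda> * (t - t0)) > 0" using \<delta> by simp
    then have "v x t > 0 \<longleftrightarrow> exp (- \<alpha>) < E x t" unfolding v_def 
      by (metis diff_gt_0_iff_gt mult_pos_pos zero_less_mult_pos)
    also have "\<dots> \<longleftrightarrow> \<alpha> * (Y x t)\<^sup>2 < \<alpha> * 1" by (simp add: E_def)
    also have "\<dots> \<longleftrightarrow> (Y x t)\<^sup>2 < 1" using \<alpha> by (simp add: mult_less_cancel_left_pos)
    finally show ?thesis by (simp add: abs_square_less_1)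
  qed
  have Ccont: "continuous_on {t0..t0 + 1} C" and Rcont: "continuous_on {t0..t0 + 1} R"
    and Lcont: "continuous_on {t0..t0 + 1} L"
    by (auto intro!: continuous_at_imp_continuous_on DERIV_isCont Cder Rder L)
  have comp: "v x t \<le> \<psi> x t" if "t \<in> {t0..t0 + 1}" "x \<in> {0..L t}" for x t
  proof (rule nonneg_solution_comparison[OF sol D lip t0 Lcont, where vt = vt and vx = vx and vxx = vxx])
    show "L t > 0" if "t \<in> {t0..t0 + 1}" for t using Lb[of t] that m1 by auto
    let ?S = "{(x, t). t0 \<le> t \<and> t \<le> t0 + 1 \<and> 0 \<le> x \<and> x \<le> L t}"
    have "continuous_on ?S (\<lambda>p. C (snd p))" "continuous_on ?S (\<lambda>p. R (snd p))"
      by (rule continuous_on_compose2[OF Ccont] continuous_on_compose2[OF Rcont]; auto intro!: continuous_intros)+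
    moreover have "\<forall>p\<in>?S. R (snd p) \<noteq> 0" using Rpos by force
    ultimately show "continuous_on ?S (\<lambda>(x, t). v x t)"
      unfolding case_prod_beta v_def E_def Y_def by (intro continuous_intros) auto
    show "v x t0 \<le> \<psi> x t0" if "x \<in> {0..L t0}" for x
    proof (cases "v x t0 > 0")
      case True
      then have "\<bar>Y x t0\<bar> < 1" using v_pos_iff by blast
      moreover have "C t0 = (a + b) / 2" "R t0 = (b - a) / 2"
        using L0 by (simp_all add: C_def R_def p_def q_def field_simps)
      ultimately have "\<bar>x - (a + b) / 2\<bar> / ((b - a) / 2) < 1"
        using ab by (simp only: Y_def abs_divide)
      then have "\<bar>x - (a + b) / 2\<bar> < (b - a) / 2" using ab by (subst (asm) pos_divide_less_eq) auto
      then have "a \<le> x" "x \<le> b" unfolding abs_less_iff by (simp_all add: field_simps)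
      then have "x \<in> {a..b}" by simp
      then have "\<delta> \<le> \<psi> x t0" by (rule \<delta>(2))
      moreover have "E x t0 \<le> 1" using \<alpha> by (simp add: E_def)
      then have "E x t0 - exp (- \<alpha>) \<le> 1" using exp_gt_zero[of "- \<alpha>"] by linarith
      then have "v x t0 \<le> \<delta>" unfolding v_def using \<delta>(1) by simp
      ultimately show ?thesis by simp
    next
      case False
      moreover have "\<psi> x t0 \<ge> 0" using sol t0 that unfolding nonneg_solution_def by auto
      ultimately show ?thesis by simp
    qed
    show "v 0 t \<le> 0" "v (L t) t \<le> 0" if t: "t \<in> {t0..t0 + 1}" for t
    proof -
      have "\<bar>Y 0 t\<bar> \<ge> 1" "\<bar>Y (L t) t\<bar> \<ge> 1" using facts(5,6)[OF t] Rpos[OF t] by (auto simp: Y_def abs_divide)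
      then show "v 0 t \<le> 0" "v (L t) t \<le> 0" using v_pos_iff by (metis not_less)+
    qed
    fix x t assume t: "t \<in> {t0<..t0 + 1}" and x: "x \<in> {0<..<L t}"
    have Rt: "R t > 0" and tt: "t0 \<le> t" using Rpos t by auto
    have Yt: "((\<lambda>s. Y x s) has_real_derivative - (C' t + Y x t * R' t) / R t) (at t)"
      unfolding Y_def using Rt
      by (auto intro!: derivative_eq_intros Cder[OF tt] Rder[OF tt] simp: field_simps)
    have Et: "((\<lambda>s. E x s) has_real_derivative
        E x t * (2 * \<alpha> * Y x t * (C' t + Y x t * R' t) / R t)) (at t)"
      unfolding E_def using Rt by (auto intro!: derivative_eq_intros Yt simp: field_simps)
    show "((\<lambda>s. v x s) has_real_derivative vt x t) (at t)"
      unfolding v_def vt_def by (auto intro!: derivative_eq_intros Et simp: algebra_simps)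
    have Yx: "((\<lambda>y. Y y t) has_real_derivative 1 / R t) (at x)"
      unfolding Y_def using Rt by (auto intro!: derivative_eq_intros)
    have Ex: "((\<lambda>y. E y t) has_real_derivative E x t * (- 2 * \<alpha> * Y x t / R t)) (at x)"
      unfolding E_def by (auto intro!: derivative_eq_intros Yx)
    show "((\<lambda>y. v y t) has_real_derivative vx x t) (at x)"
      unfolding v_def vx_def by (auto intro!: derivative_eq_intros Ex)
    show "((\<lambda>y. vx y t) has_real_derivative vxx x t) (at x)"
      unfolding vx_def vxx_def using Rt
      by (auto intro!: derivative_eq_intros Yx Ex simp: field_simps power2_eq_square)
    assume gt: "\<psi> x t < v x t"
    moreover have "\<psi> x t \<ge> 0" using sol t0 t x unfolding nonneg_solution_def by auto
    ultimately have vpos: "v x t > 0" by simp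
    have "\<bar>f (v x t) - f 0\<bar> \<le> K * \<bar>v x t - 0\<bar>"
      using lipschitz_onD[OF lip, of "v x t" 0] vpos by (auto simp: dist_real_def)
    then have "- K * v x t \<le> f (v x t)" using f0 vpos by simp
    moreover have "vt x t \<le> D * vxx x t - K * v x t"
    proof -
      have "- \<Lambda> * (E x t - exp (- \<alpha>)) + E x t * (2 * \<alpha> * Y x t * (C' t + Y x t * R' t) / R t)
        \<le> D * (E x t * (4 * \<alpha>\<^sup>2 * (Y x t)\<^sup>2 / (R t)\<^sup>2 - 2 * \<alpha> / (R t)\<^sup>2)) - K * (E x t - exp (- \<alpha>))"
        unfolding E_def using facts(1-4)[of t] t vpos v_pos_iff
        by (intro moving_bump_inequality[OF D R0, where B = B2 and m = m2]) (auto simp: \<alpha>_def \<Lambda>_def)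
      then have "vt x t \<le> \<delta> * exp (- \<Lambda> * (t - t0)) *
        (D * (E x t * (4 * \<alpha>\<^sup>2 * (Y x t)\<^sup>2 / (R t)\<^sup>2 - 2 * \<alpha> / (R t)\<^sup>2)) - K * (E x t - exp (- \<alpha>)))"
        unfolding vt_def using \<delta> by (intro mult_left_mono) auto
      then show ?thesis unfolding vxx_def v_def by (simp add: algebra_simps)
    qed
    ultimately show "vt x t \<le> D * vxx x t + f (v x t)" by linarith
  qed (use that in auto)
  let ?t1 = "t0 + 1"
  define c where "c = \<delta> * exp (- \<Lambda>) * (exp (- \<alpha>) * \<alpha> * (2 / pi))"
  have "c > 0" using \<delta> \<alpha> by (simp add: c_def)
  moreover have "c * sin (pi * x / L ?t1) \<le> \<psi> x ?t1" if x: "x \<in> {0..L ?t1}" for x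
  proof -
    have L1: "L ?t1 > 0" using Lb[of ?t1] m1 by simp
    define z where "z = x / L ?t1"
    have z: "0 \<le> z" "z \<le> 1" using x L1 by (auto simp: z_def)
    have Yz: "Y x ?t1 = 2 * z - 1" using L1 by (simp add: Y_def C_def R_def z_def field_simps)
    then have y: "1 - (Y x ?t1)\<^sup>2 = 4 * (z * (1 - z))"
      unfolding Yz by (simp add: power2_eq_square algebra_simps)
    have "2 / pi * sin (pi * z) \<le> 2 / pi * (2 * pi * (z * (1 - z)))"
      using sin_pi_le_parabola[OF z] by (intro mult_left_mono) auto
    then have s: "2 / pi * sin (pi * z) \<le> 1 - (Y x ?t1)\<^sup>2" unfolding y by simp
    have "exp (- \<alpha>) * \<alpha> * (2 / pi * sin (pi * z)) \<le> exp (- \<alpha>) * \<alpha> * (1 - (Y x ?t1)\<^sup>2)"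
      using \<alpha> s by (intro mult_left_mono) auto
    also have "\<dots> = exp (- \<alpha>) * (\<alpha> * (1 - (Y x ?t1)\<^sup>2))" by simp
    also have "\<dots> \<le> exp (- \<alpha>) * (exp (\<alpha> * (1 - (Y x ?t1)\<^sup>2)) - 1)"
      using exp_ge_add_one_self[of "\<alpha> * (1 - (Y x ?t1)\<^sup>2)"]
      by (intro mult_left_mono exp_ge_zero) linarith
    also have "\<dots> = E x ?t1 - exp (- \<alpha>)"
      by (simp add: E_def algebra_simps flip: exp_add)
    finally have "\<delta> * exp (- \<Lambda>) * (exp (- \<alpha>) * \<alpha> * (2 / pi * sin (pi * z)))
        \<le> \<delta> * exp (- \<Lambda>) * (E x ?t1 - exp (- \<alpha>))"
      using \<delta> by (intro mult_left_mono) auto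
    also have "\<dots> = v x ?t1" by (simp add: v_def)
    also have "\<dots> \<le> \<psi> x ?t1" using comp x by simp
    finally show ?thesis by (simp add: c_def z_def mult.assoc)
  qed
  ultimately show ?thesis by blast
qed

lemma nonneg_solution_positive_at_early_time:
  fixes L :: "real \<Rightarrow> real"
  assumes sol: "nonneg_solution D f L \<psi>" and Lcont: "continuous_on {0..} L"
    and x0: "x0 \<in> {0..L 0}" "\<psi> x0 0 \<noteq> 0"
  shows "\<exists>t0>0. \<exists>a b \<delta>. 0 \<le> a \<and> a < b \<and> b \<le> L t0 \<and> \<delta> > 0 \<and> (\<forall>x\<in>{a..b}. \<delta> \<le> \<psi> x t0)"
proof -
  let ?S = "{(x, t). 0 \<le> t \<and> 0 \<le> x \<and> x \<le> L t} - {(0, 0), (L 0, 0)}"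
  have "\<psi> 0 0 = 0" "\<psi> (L 0) 0 = 0" "\<psi> x0 0 \<ge> 0"
    using sol x0 unfolding nonneg_solution_def by auto
  then have x0': "0 < x0" "x0 < L 0" "\<psi> x0 0 > 0"
    using x0 by (auto simp: less_le)
  have cont: "continuous_on ?S (\<lambda>(x, t). \<psi> x t)" using sol unfolding nonneg_solution_def by blast
  have "(x0, 0) \<in> ?S" "\<psi> x0 0 / 2 > 0" using x0' by auto
  from cont[unfolded continuous_on_iff, rule_format, OF this]
  obtain d where d: "d > 0" "\<And>p. p \<in> ?S \<Longrightarrow> dist p (x0, 0) < d \<Longrightarrow>
      dist (case p of (x, t) \<Rightarrow> \<psi> x t) (\<psi> x0 0) < \<psi> x0 0 / 2"
    unfolding case_prod_conv by blast
  obtain d2 where d2: "d2 > 0" "\<And>t. t \<in> {0..} \<Longrightarrow> dist t 0 < d2 \<Longrightarrow> dist (L t) (L 0) < (L 0 - x0) / 2"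
    using Lcont[unfolded continuous_on_iff, rule_format, of 0 "(L 0 - x0) / 2"] x0' by auto
  define t0 where "t0 = min d d2 / 2"
  define \<eta> where "\<eta> = min (d / 4) (min x0 ((L 0 - x0) / 4))"
  have t0: "0 < t0" "t0 \<le> d / 2" "t0 < d2" using d(1) d2(1) by (auto simp: t0_def min_def)
  have \<eta>: "0 < \<eta>" "\<eta> < d / 2" "\<eta> \<le> x0" "\<eta> \<le> (L 0 - x0) / 4"
    using d(1) x0' by (auto simp: \<eta>_def min_def)
  have "dist (L t0) (L 0) < (L 0 - x0) / 2" using d2(2)[of t0] t0 by (auto simp: dist_real_def)
  then have "L 0 - L t0 < (L 0 - x0) / 2" unfolding dist_real_def by linarith
  then have Lt0: "x0 + \<eta> < L t0" using \<eta>(4) x0'(2) by (simp add: field_simps)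
  have "\<psi> x0 0 / 2 \<le> \<psi> x t0" if x: "x \<in> {x0 - \<eta>..x0 + \<eta>}" for x
  proof -
    have "dist (x, t0) (x0, 0) \<le> \<bar>x - x0\<bar> + \<bar>t0\<bar>"
      by (simp add: dist_Pair_Pair dist_real_def sqrt_sum_squares_le_sum_abs)
    also have "\<dots> < d" using x t0 \<eta> by auto
    finally have "dist (\<psi> x t0) (\<psi> x0 0) < \<psi> x0 0 / 2"
      using d(2)[of "(x, t0)"] x t0 \<eta> Lt0 by auto
    then show ?thesis unfolding dist_real_def by linarith
  qed
  then show ?thesis using t0 \<eta> Lt0 x0'
    by (intro exI[of _ t0] conjI exI[of _ "x0 - \<eta>"] exI[of _ "x0 + \<eta>"] exI[of _ "\<psi> x0 0 / 2"]) auto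
qed

section \<open>The moving sine subsolution\<close>

text \<open>With \<open>S = sin (\<pi> x / L)\<close>, \<open>h = g - L' x\<^sup>2 / (4 D L)\<close> and \<open>v = e\<^sup>h S\<close>, the terms with \<open>S_x\<close>
  cancel because \<open>S_t = 2 D h_x S_x\<close>, and \<open>D h_x\<^sup>2\<close> cancels the part of \<open>h_t\<close> quadratic in \<open>L'\<close>. This
  leaves
    \<open>v_t - D v_xx - r v = v (g' - r + D \<pi>\<^sup>2 / L\<^sup>2 + L' / (2 L) - x\<^sup>2 L'' / (4 D L))\<close>,
  where the last term is at most \<open>L [L'']\<^sup>- / (4 D)\<close>, so that the assumed \<open>g'\<close> makes the right-hand
  side nonpositive.\<close>

lemma moving_sine_subsolution_bound:
  fixes L L' L'' g :: "real \<Rightarrow> real"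
  assumes sol: "nonneg_solution D f L \<psi>" and D: "D > 0" and lip: "K-lipschitz_on {0..} f"
    and k0: "k0 > 0" "\<And>k. 0 \<le> k \<Longrightarrow> k \<le> k0 \<Longrightarrow> f k = r * k"
    and t1: "0 < t1"
    and L: "\<And>t. t1 \<le> t \<Longrightarrow> (L has_real_derivative L' t) (at t)"
    and L': "\<And>t. t1 \<le> t \<Longrightarrow> (L' has_real_derivative L'' t) (at t)"
    and Lpos: "\<And>t. t1 \<le> t \<Longrightarrow> L t > 0"
    and g: "\<And>t. t1 \<le> t \<Longrightarrow> (g has_real_derivative
        r - D * (pi / L t)\<^sup>2 - L' t / (2 * L t) - L t * neg_part (L'' t) / (4 * D)) (at t)"
    and Gbd: "\<And>t x. t1 \<le> t \<Longrightarrow> x \<in> {0..L t} \<Longrightarrow>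
        g t - L' t * x\<^sup>2 / (4 * D * L t) \<in> {Glo..Gup}"
    and c: "c > 0" "\<And>x. x \<in> {0..L t1} \<Longrightarrow> c * sin (pi * x / L t1) \<le> \<psi> x t1"
  shows "\<exists>c'>0. \<forall>t\<ge>t1. \<forall>x\<in>{0..L t}. c' * sin (pi * x / L t) \<le> \<psi> x t"
proof -
  \<comment> \<open>The factor \<open>k0\<close> keeps the subsolution in the linear range of \<open>f\<close>, and \<open>c\<close> keeps it below
    the solution at time \<open>t1\<close>.\<close>
  define \<epsilon> where "\<epsilon> = min k0 c * exp (- Gup)"
  have \<epsilon>: "\<epsilon> > 0" using k0 c by (simp add: \<epsilon>_def)
  define E where "E = (\<lambda>x t. exp (g t - L' t * x\<^sup>2 / (4 * D * L t)))"
  define S where "S = (\<lambda>x t. sin (pi * x / L t))"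
  define C where "C = (\<lambda>x t. cos (pi * x / L t))"
  define v where "v = (\<lambda>x t. \<epsilon> * E x t * S x t)"
  define vx where "vx = (\<lambda>x t. \<epsilon> * E x t * (pi / L t * C x t - L' t * x / (2 * D * L t) * S x t))"
  define vxx where "vxx = (\<lambda>x t. \<epsilon> * E x t *
      ((- ((pi / L t)\<^sup>2) - L' t / (2 * D * L t) + (L' t * x / (2 * D * L t))\<^sup>2) * S x t
        - L' t * x / (D * L t) * (pi / L t) * C x t))"
  define g' where "g' = (\<lambda>t. r - D * (pi / L t)\<^sup>2 - L' t / (2 * L t) - L t * neg_part (L'' t) / (4 * D))"
  define vt where "vt = (\<lambda>x t. \<epsilon> * E x t *
      ((g' t - x\<^sup>2 / (4 * D) * (L'' t / L t - (L' t / L t)\<^sup>2)) * S x t - pi * x * L' t / (L t)\<^sup>2 * C x t))"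
  have S0: "0 \<le> S x t" if "t1 \<le> t" "x \<in> {0..L t}" for x t
    unfolding S_def using that Lpos[of t] by (intro sin_ge_zero) (auto simp: field_simps)
  have Ebd: "exp Glo \<le> E x t" "E x t \<le> exp Gup" if "t1 \<le> t" "x \<in> {0..L t}" for x t
    using Gbd[OF that] by (auto simp: E_def)
  have vmin: "v x t \<le> min k0 c * S x t" if "t1 \<le> t" "x \<in> {0..L t}" for x t
  proof -
    have "\<epsilon> * E x t \<le> \<epsilon> * exp Gup" using Ebd[OF that] \<epsilon> by (intro mult_left_mono) auto
    also have "\<dots> = min k0 c" by (simp add: \<epsilon>_def flip: exp_add)
    finally show ?thesis unfolding v_def using S0[OF that] by (intro mult_right_mono)
  qed
  have comp: "v x t \<le> \<psi> x t" if "t1 \<le> t" "x \<in> {0..L t}" for x t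
  proof (rule nonneg_solution_comparison[where ?t1.0 = t and vt = vt and vx = vx and vxx = vxx, OF sol D lip t1])
    show Lcont: "continuous_on {t1..t} L"
      by (auto intro!: continuous_at_imp_continuous_on DERIV_isCont L)
    have L'cont: "continuous_on {t1..t} L'"
      by (auto intro!: continuous_at_imp_continuous_on DERIV_isCont L')
    have gcont: "continuous_on {t1..t} g"
      by (auto intro!: continuous_at_imp_continuous_on DERIV_isCont g)
    show "L s > 0" if "s \<in> {t1..t}" for s using Lpos that by auto
    let ?S = "{(x, s). t1 \<le> s \<and> s \<le> t \<and> 0 \<le> x \<and> x \<le> L s}"
    have "continuous_on ?S (\<lambda>p. L (snd p))" "continuous_on ?S (\<lambda>p. L' (snd p))"
      "continuous_on ?S (\<lambda>p. g (snd p))"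
      by (rule continuous_on_compose2[OF Lcont] continuous_on_compose2[OF L'cont]
          continuous_on_compose2[OF gcont]; auto intro!: continuous_intros)+
    moreover have "\<forall>p\<in>?S. L (snd p) \<noteq> 0" using Lpos by force
    ultimately show "continuous_on ?S (\<lambda>(x, s). v x s)"
      unfolding case_prod_beta v_def E_def S_def using D by (intro continuous_intros) auto
    show "v x t1 \<le> \<psi> x t1" if x: "x \<in> {0..L t1}" for x
    proof -
      have "v x t1 \<le> min k0 c * S x t1" using vmin x by simp
      also have "\<dots> \<le> c * S x t1" using S0[of t1 x] x by (intro mult_right_mono) auto
      finally show ?thesis using c(2)[OF x] by (simp add: S_def)
    qed
    show "v 0 s \<le> 0" "v (L s) s \<le> 0" if "s \<in> {t1..t}" for s
      using Lpos[of s] that by (auto simp: v_def S_def)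
    fix y s assume s: "s \<in> {t1<..t}" and y: "y \<in> {0<..<L s}"
    have s1: "t1 \<le> s" and Ls: "L s > 0" using s Lpos[of s] by auto
    have Et: "(E y has_real_derivative E y s *
        (g' s - y\<^sup>2 / (4 * D) * (L'' s / L s - (L' s / L s)\<^sup>2))) (at s)"
      unfolding E_def g'_def using D Ls
      by (auto intro!: derivative_eq_intros L[OF s1] L'[OF s1] g[OF s1] simp: field_simps power2_eq_square)
    have St: "(S y has_real_derivative - pi * y * L' s / (L s)\<^sup>2 * C y s) (at s)"
      unfolding S_def C_def using Ls
      by (auto intro!: derivative_eq_intros L[OF s1] simp: field_simps power2_eq_square)
    show "((\<lambda>s. v y s) has_real_derivative vt y s) (at s)"
      unfolding v_def vt_def
      by (auto intro!: derivative_eq_intros Et St simp: algebra_simps)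
    have Ex: "((\<lambda>y. E y s) has_real_derivative E y s * (- L' s * y / (2 * D * L s))) (at y)"
      unfolding E_def using D Ls by (auto intro!: derivative_eq_intros simp: field_simps)
    have Sx: "((\<lambda>y. S y s) has_real_derivative pi / L s * C y s) (at y)"
      and Cx: "((\<lambda>y. C y s) has_real_derivative - (pi / L s) * S y s) (at y)"
      unfolding S_def C_def using Ls by (auto intro!: derivative_eq_intros)
    show "((\<lambda>y. v y s) has_real_derivative vx y s) (at y)"
      unfolding v_def vx_def
      by (auto intro!: derivative_eq_intros Ex Sx simp: algebra_simps)
    show "((\<lambda>y. vx y s) has_real_derivative vxx y s) (at y)"
      unfolding vx_def vxx_def using D Ls
      by (auto intro!: derivative_eq_intros Ex Sx Cx simp: field_simps power2_eq_square)
    have yL: "y \<in> {0..L s}" using y by auto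
    have S: "0 \<le> S y s" using S0[OF s1 yL] .
    have E: "0 < E y s" by (simp add: E_def)
    have "min k0 c * S y s \<le> min k0 c * 1"
      using k0 c by (intro mult_left_mono) (auto simp: S_def)
    then have "v y s \<le> k0" using vmin[OF s1 yL] by auto
    moreover have "0 \<le> v y s" using S E \<epsilon> by (simp add: v_def)
    ultimately have fv: "f (v y s) = r * v y s" using k0 by blast
    have neg: "- (y\<^sup>2 * L'' s / (4 * D * L s)) - L s * neg_part (L'' s) / (4 * D) \<le> 0"
    proof -
      have "- (y\<^sup>2 * L'' s) \<le> y\<^sup>2 * neg_part (L'' s)"
        using mult_left_mono[of "- L'' s" "neg_part (L'' s)" "y\<^sup>2"] by (simp add: neg_part_def)
      also have "\<dots> \<le> (L s)\<^sup>2 * neg_part (L'' s)"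
        using y by (intro mult_right_mono power_mono) (auto simp: neg_part_def)
      finally have "- (y\<^sup>2 * L'' s) / (4 * D * L s) \<le> (L s)\<^sup>2 * neg_part (L'' s) / (4 * D * L s)"
        using D Ls by (intro divide_right_mono) auto
      then show ?thesis using Ls by (simp add: power2_eq_square)
    qed
    have "vt y s - D * vxx y s - r * v y s = \<epsilon> * E y s * S y s *
        (- (y\<^sup>2 * L'' s / (4 * D * L s)) - L s * neg_part (L'' s) / (4 * D))"
      unfolding vt_def vxx_def v_def g'_def using D Ls
      by (simp add: field_simps power2_eq_square)
    also have "\<dots> \<le> 0" using neg \<epsilon> E S by (intro mult_nonneg_nonpos) auto
    finally show "vt y s \<le> D * vxx y s + f (v y s)" unfolding fv by simp
  qed (use that in auto)
  have "\<epsilon> * exp Glo * sin (pi * x / L t) \<le> \<psi> x t" if "t1 \<le> t" "x \<in> {0..L t}" for x t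
  proof -
    have "\<epsilon> * exp Glo * S x t \<le> v x t"
      unfolding v_def using Ebd[OF that] S0[OF that] \<epsilon> by (intro mult_right_mono mult_left_mono) auto
    then show ?thesis using comp[OF that] by (simp add: S_def)
  qed
  then show ?thesis using \<epsilon> by (intro exI[of _ "\<epsilon> * exp Glo"]) auto
qed

section \<open>Persistence\<close>

lemma sine_moment_ge:
  fixes l :: real
  assumes l: "l > 0" and \<phi>: "continuous_on {0..l} \<phi>"
    and ge: "\<And>x. x \<in> {0..l} \<Longrightarrow> c * sin (pi * x / l) \<le> \<phi> x"
  shows "c \<le> 2 / l * integral {0..l} (\<lambda>x. \<phi> x * sin (pi * x / l))"
proof -
  have "((\<lambda>x. c * (sin (pi * x / l))\<^sup>2) has_integral
      (c * (l / 2 - l / (4 * pi) * sin (2 * (pi * l / l))) - c * (0 / 2 - l / (4 * pi) * sin (2 * (pi * 0 / l))))) {0..l}"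
  proof (rule fundamental_theorem_of_calculus)
    fix x assume "x \<in> {0..l}"
    have "((\<lambda>x. c * (x / 2 - l / (4 * pi) * sin (2 * (pi * x / l)))) has_real_derivative
        c * ((1 - cos (2 * (pi * x / l))) / 2)) (at x within {0..l})"
      using l by (auto intro!: derivative_eq_intros simp: field_simps)
    also have "c * ((1 - cos (2 * (pi * x / l))) / 2) = c * (sin (pi * x / l))\<^sup>2"
      unfolding cos_double_sin by simp
    finally show "((\<lambda>x. c * (x / 2 - l / (4 * pi) * sin (2 * (pi * x / l)))) has_vector_derivative
        c * (sin (pi * x / l))\<^sup>2) (at x within {0..l})"
      by (simp add: has_real_derivative_iff_has_vector_derivative)
  qed (use l in auto)
  then have "((\<lambda>x. c * (sin (pi * x / l))\<^sup>2) has_integral c * (l / 2)) {0..l}"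
    using l by simp
  moreover have "(\<lambda>x. \<phi> x * sin (pi * x / l)) integrable_on {0..l}"
    using l by (intro integrable_continuous_interval continuous_intros \<phi>) auto
  moreover have "c * (sin (pi * x / l))\<^sup>2 \<le> \<phi> x * sin (pi * x / l)" if "x \<in> {0..l}" for x
  proof -
    have "0 \<le> sin (pi * x / l)" using that l by (intro sin_ge_zero) (auto simp: field_simps)
    then show ?thesis
      using mult_right_mono[OF ge[OF that]] by (simp add: power2_eq_square mult.assoc)
  qed
  ultimately have "c * (l / 2) \<le> integral {0..l} (\<lambda>x. \<phi> x * sin (pi * x / l))"
    by (intro has_integral_le[OF _ integrable_integral]) auto
  then have "2 / l * (c * (l / 2)) \<le> 2 / l * integral {0..l} (\<lambda>x. \<phi> x * sin (pi * x / l))"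
    using l by (intro mult_left_mono) auto
  then show ?thesis using l by simp
qed

theorem proposition4p1:
  fixes D r k0 m1 m2 M I1 I2 :: real
    and f L L' L'' :: "real \<Rightarrow> real"
    and \<psi> :: "real \<Rightarrow> real \<Rightarrow> real"
  assumes "D > 0"
    and "KPP_type f r"
    and "k0 > 0" and "\<And>k. 0 \<le> k \<Longrightarrow> k \<le> k0 \<Longrightarrow> f k = r * k"
    and "\<And>t. t \<ge> 0 \<Longrightarrow> (L has_real_derivative L' t) (at t within {0..})"
    and "\<And>t. t \<ge> 0 \<Longrightarrow> (L' has_real_derivative L'' t) (at t within {0..})"
    and "continuous_on {0..} L''"
    and "0 < m1"
    and "\<And>t. t \<ge> 0 \<Longrightarrow> m1 \<le> L t \<and> L t \<le> m2"
    and "\<And>t. t \<ge> 0 \<Longrightarrow> \<bar>L' t * L t\<bar> \<le> M"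
    and "\<And>t. t \<ge> 0 \<Longrightarrow> \<bar>integral {0..t} (\<lambda>\<zeta>. 1 / (L \<zeta>)\<^sup>2 - 1 / (L_crit D r)\<^sup>2)\<bar> \<le> I1"
    and "\<And>t. t \<ge> 0 \<Longrightarrow> integral {0..t} (\<lambda>\<zeta>. L \<zeta> * neg_part (L'' \<zeta>)) \<le> I2"
    and "nonneg_solution D f L \<psi>"
    and "\<exists>x\<in>{0..L 0}. \<psi> x 0 \<noteq> 0"
  shows "\<not> tends_to_zero L \<psi> \<and>
    Liminf at_top (\<lambda>t. ereal (2 / L t * integral {0..L t} (\<lambda>x. \<psi> x t * sin (pi * x / L t)))) > 0"
proof -
  note D = assms(1) and k0 = assms(3,4) and m1 = assms(8) and Lb = assms(9) and M = assms(10)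
    and I1 = assms(11) and I2 = assms(12) and sol = assms(13)
  obtain K where lip: "K-lipschitz_on {0..} f" and f0: "f 0 = 0" and r: "r > 0"
    using assms(2) unfolding KPP_type_def by blast
  have interior: "at t within {0..} = at t" if "t > 0" for t :: real
    using that by (intro at_within_interior) auto
  have L: "(L has_real_derivative L' t) (at t)" and L': "(L' has_real_derivative L'' t) (at t)"
    if "t > 0" for t
    using assms(5,6)[of t] that by (auto simp: interior)
  have Lcont: "continuous_on {0..} L"
    using assms(5) by (auto intro!: DERIV_continuous_on)
  have Lpos: "L t > 0" if "t \<ge> 0" for t using Lb[OF that] m1 by simp
  have L'b: "\<bar>L' t\<bar> \<le> M / m1" if "t \<ge> 0" for t
  proof -
    have "\<bar>L' t\<bar> * m1 \<le> \<bar>L' t\<bar> * L t" using Lb[OF that] by (intro mult_left_mono) auto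
    also have "\<dots> \<le> M" using M[OF that] Lpos[OF that] by (simp add: abs_mult)
    finally show ?thesis using m1 by (simp add: pos_le_divide_eq)
  qed
  obtain x0 where "x0 \<in> {0..L 0}" "\<psi> x0 0 \<noteq> 0" using assms(14) by blast
  from nonneg_solution_positive_at_early_time[OF sol Lcont this]
  obtain t0 a b \<delta> where t0: "t0 > 0" and ab: "0 \<le> a" "a < b" "b \<le> L t0" and \<delta>: "\<delta> > 0"
    "\<And>x. x \<in> {a..b} \<Longrightarrow> \<delta> \<le> \<psi> x t0" by blast
  have "\<exists>c>0. \<forall>x\<in>{0..L (t0 + 1)}. c * sin (pi * x / L (t0 + 1)) \<le> \<psi> x (t0 + 1)"
    using t0 Lb L'b L
    by (intro nonneg_solution_ge_sin_after_unit_time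
        [where L' = L' and B = "M / m1" and ?m2.0 = m2, OF sol D lip f0 t0 _ m1 _ _ ab \<delta>]) auto
  then obtain c where c: "c > 0" "\<And>x. x \<in> {0..L (t0 + 1)} \<Longrightarrow> c * sin (pi * x / L (t0 + 1)) \<le> \<psi> x (t0 + 1)"
    by blast
  define G1 where "G1 = (\<lambda>t. integral {0..t} (\<lambda>\<zeta>. 1 / (L \<zeta>)\<^sup>2 - 1 / (L_crit D r)\<^sup>2))"
  define G2 where "G2 = (\<lambda>t. integral {0..t} (\<lambda>\<zeta>. L \<zeta> * neg_part (L'' \<zeta>)))"
  define g where "g = (\<lambda>t. - D * pi\<^sup>2 * G1 t - ln (L t) / 2 - G2 t / (4 * D))"
  have cont1: "continuous_on {0..} (\<lambda>\<zeta>. 1 / (L \<zeta>)\<^sup>2 - 1 / (L_crit D r)\<^sup>2)"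
    using Lpos by (intro continuous_intros Lcont) (auto simp: less_imp_neq[symmetric])
  have cont2: "continuous_on {0..} (\<lambda>\<zeta>. L \<zeta> * neg_part (L'' \<zeta>))"
    unfolding neg_part_def by (intro continuous_intros Lcont assms(7))
  have FTC: "((\<lambda>t. integral {0..t} h) has_real_derivative h t) (at t)"
    if "continuous_on {0..} h" "t > 0" for h :: "real \<Rightarrow> real" and t
  proof -
    have "((\<lambda>t. integral {0..t} h) has_real_derivative h t) (at t within {0..t + 1})"
      using that by (intro integral_has_real_derivative) (auto elim: continuous_on_subset)
    moreover have "at t within {0..t + 1} = at t" using that by (intro at_within_interior) auto
    ultimately show ?thesis by simp
  qed
  have crit: "D * pi\<^sup>2 / (L_crit D r)\<^sup>2 = r"
    using D r by (simp add: L_crit_def power_mult_distrib)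
  have g: "(g has_real_derivative
      r - D * (pi / L t)\<^sup>2 - L' t / (2 * L t) - L t * neg_part (L'' t) / (4 * D)) (at t)"
    if "t > 0" for t
  proof -
    have "(g has_real_derivative - D * pi\<^sup>2 * (1 / (L t)\<^sup>2 - 1 / (L_crit D r)\<^sup>2) - L' t / L t / 2
        - L t * neg_part (L'' t) / (4 * D)) (at t)"
      unfolding g_def G1_def G2_def using Lpos[of t] that D
      by (auto intro!: derivative_eq_intros FTC cont1 cont2 L)
    also have "- D * pi\<^sup>2 * (1 / (L t)\<^sup>2 - 1 / (L_crit D r)\<^sup>2) - L' t / L t / 2
        = D * pi\<^sup>2 / (L_crit D r)\<^sup>2 - D * (pi / L t)\<^sup>2 - L' t / (2 * L t)"
      by (simp add: algebra_simps power_divide)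
    finally show ?thesis unfolding crit .
  qed
  define Glo where "Glo = - D * pi\<^sup>2 * I1 - ln m2 / 2 - I2 / (4 * D) - M / (4 * D)"
  define Gup where "Gup = D * pi\<^sup>2 * I1 - ln m1 / 2 + M / (4 * D)"
  have Gbd: "g t - L' t * x\<^sup>2 / (4 * D * L t) \<in> {Glo..Gup}" if t: "t \<ge> 0" and x: "x \<in> {0..L t}" for t x
  proof -
    have "\<bar>D * pi\<^sup>2 * G1 t\<bar> \<le> D * pi\<^sup>2 * I1"
      unfolding abs_mult using I1[OF t] D by (simp add: G1_def)
    moreover have "ln m1 \<le> ln (L t)" "ln (L t) \<le> ln m2" using Lb[OF t] m1 by auto
    moreover have "0 \<le> G2 t"
      unfolding G2_def using Lpos
      by (intro Henstock_Kurzweil_Integration.integral_nonneg integrable_continuous_interval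
          continuous_on_subset[OF cont2] mult_nonneg_nonneg)
        (auto simp: neg_part_def less_imp_le)
    then have "0 \<le> G2 t / (4 * D)" using D by simp
    moreover have "G2 t / (4 * D) \<le> I2 / (4 * D)"
      unfolding G2_def using I2[OF t] D by (intro divide_right_mono) auto
    moreover have "\<bar>L' t * x\<^sup>2 / (4 * D * L t)\<bar> \<le> M / (4 * D)"
    proof -
      have "\<bar>L' t\<bar> * x\<^sup>2 \<le> \<bar>L' t\<bar> * (L t)\<^sup>2" using x by (intro mult_left_mono power_mono) auto
      also have "\<dots> = \<bar>L' t * L t\<bar> * L t" using Lpos[OF t] by (simp add: abs_mult power2_eq_square)
      also have "\<dots> \<le> M * L t" using M[OF t] Lpos[OF t] by (intro mult_right_mono) auto
      finally have "\<bar>L' t\<bar> * x\<^sup>2 / (4 * D * L t) \<le> M * L t / (4 * D * L t)"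
        using D Lpos[OF t] by (intro divide_right_mono) auto
      then show ?thesis using D Lpos[OF t] by (simp add: abs_mult)
    qed
    ultimately show ?thesis unfolding Glo_def Gup_def g_def abs_le_iff atLeastAtMost_iff
      by linarith
  qed
  have "\<exists>c'>0. \<forall>t\<ge>t0 + 1. \<forall>x\<in>{0..L t}. c' * sin (pi * x / L t) \<le> \<psi> x t"
    by (rule moving_sine_subsolution_bound[where g = g and Glo = Glo and Gup = Gup
          and L' = L' and L'' = L'' and c = c and ?t1.0 = "t0 + 1", OF sol D lip k0(1)])
      (use t0 L L' Lpos g Gbd k0(2) c in auto)
  then obtain c' where c': "c' > 0"
    "\<And>t x. t0 + 1 \<le> t \<Longrightarrow> x \<in> {0..L t} \<Longrightarrow> c' * sin (pi * x / L t) \<le> \<psi> x t" by blast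
  have moment: "c' \<le> 2 / L t * integral {0..L t} (\<lambda>x. \<psi> x t * sin (pi * x / L t))"
    if "t0 + 1 \<le> t" for t
  proof (rule sine_moment_ge)
    have "continuous_on ({(x, t). 0 \<le> t \<and> 0 \<le> x \<and> x \<le> L t} - {(0, 0), (L 0, 0)}) (\<lambda>(x, t). \<psi> x t)"
      using sol unfolding nonneg_solution_def by blast
    then have "continuous_on {0..L t} (\<lambda>x. (\<lambda>(x, t). \<psi> x t) (x, t))"
      by (rule continuous_on_compose2) (use t0 that in \<open>auto intro!: continuous_intros\<close>)
    then show "continuous_on {0..L t} (\<lambda>x. \<psi> x t)" by simp
  qed (use that t0 Lpos[of t] c'(2) in auto)
  have lim: "ereal c' \<le> Liminf at_top (\<lambda>t. ereal (2 / L t * integral {0..L t} (\<lambda>x. \<psi> x t * sin (pi * x / L t))))"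
    by (intro Liminf_bounded eventually_mono[OF eventually_ge_at_top[of "t0 + 1"]]) (auto dest: moment)
  have "0 < Liminf at_top (\<lambda>t. ereal (2 / L t * integral {0..L t} (\<lambda>x. \<psi> x t * sin (pi * x / L t))))"
    using less_le_trans[OF _ lim, of 0] c'(1) by simp
  moreover have "\<not> tends_to_zero L \<psi>"
  proof
    assume "tends_to_zero L \<psi>"
    then have lim0: "((\<lambda>t. if m1 / 2 \<in> {0..L t} then \<psi> (m1 / 2) t else 0) \<longlongrightarrow> 0) at_top"
      unfolding tends_to_zero_def by blast
    have m2: "m1 \<le> m2" using Lb[of 0] by simp
    define w where "w = c' * sin (pi * (m1 / 2) / m2)"
    have "0 < pi * (m1 / 2) / m2" "pi * (m1 / 2) / m2 < pi" using m1 m2 by (auto simp: field_simps)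
    then have "w > 0" using c' by (simp add: w_def sin_gt_zero)
    from order_tendstoD(2)[OF lim0 this]
    have "eventually (\<lambda>t. (if m1 / 2 \<in> {0..L t} then \<psi> (m1 / 2) t else 0) < w) at_top" .
    then obtain N where N: "\<And>t. t \<ge> N \<Longrightarrow> (if m1 / 2 \<in> {0..L t} then \<psi> (m1 / 2) t else 0) < w"
      unfolding eventually_at_top_linorder by blast
    define t where "t = max N (t0 + 1)"
    have t: "t0 + 1 \<le> t" "N \<le> t" "0 \<le> t" using t0 by (auto simp: t_def)
    have x: "m1 / 2 \<in> {0..L t}" using Lb[OF t(3)] m1 by auto
    have "sin (pi * (m1 / 2) / m2) \<le> sin (pi * (m1 / 2) / L t)"
    proof (rule sin_monotone_2pi_le)
      show "pi * (m1 / 2) / m2 \<le> pi * (m1 / 2) / L t"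
        using Lb[OF t(3)] m1 by (intro divide_left_mono) auto
      show "pi * (m1 / 2) / L t \<le> pi / 2"
      proof -
        have "m1 / L t \<le> 1" using Lb[OF t(3)] m1 by simp
        then have "pi / 2 * (m1 / L t) \<le> pi / 2 * 1" by (intro mult_left_mono) auto
        then show ?thesis by simp
      qed
      show "- (pi / 2) \<le> pi * (m1 / 2) / m2"
        using \<open>0 < pi * (m1 / 2) / m2\<close> pi_gt_zero by linarith
    qed
    then have "w \<le> c' * sin (pi * (m1 / 2) / L t)" unfolding w_def using c' by (intro mult_left_mono) auto
    also have "\<dots> \<le> \<psi> (m1 / 2) t" using c'(2)[OF t(1) x] .
    finally show False using N[OF t(2)] x by simp
  qed
  ultimately show ?thesis by blast
qed

end
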